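(* For all $a,b\in\mathbb{Z}_{>0}$ with $a>b$, $$\Omega(a,b)=(-1)^{b+1}(b-1)!\binom{a-1}{b}.$$
   Context: The integers $\Omega(a,b)$, for $a\in\mathbb{Z}_{>0}$ and $b\in\mathbb{Z}_{\ge 0}$, are defined recursively by: $\Omega(a,0)=1$; $\Omega(a,b)=0$ if $b\ge a$ and $b\ge 1$; $\Omega(a,1)=\Omega(a-1,1)+1$ for $a\ge 2$; and $\Omega(a,b)=\Omega(a-1,b)-(b-1)\,\Omega(a-1,b-1)$ for $2\le b\le a-1$. *)

theory Defs
  imports Complex_Main
begin

text \<open>
  The first argument is meant to be positive. The value at \<open>a = 0\<close>, which the
  mathematical definition leaves out, comes from letting the first two clauses apply there
  too; the recursive clauses never reach it. All differences of natural numbers below are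
  free of truncation.
\<close>

function Omega :: "nat \<Rightarrow> nat \<Rightarrow> int" where
  "Omega a 0 = 1"
| "b \<ge> a \<Longrightarrow> b \<ge> 1 \<Longrightarrow> Omega a b = 0"
| "a \<ge> 2 \<Longrightarrow> Omega a 1 = Omega (a - 1) 1 + 1"
| "2 \<le> b \<Longrightarrow> b \<le> a - 1 \<Longrightarrow>
     Omega a b = Omega (a - 1) b - int (b - 1) * Omega (a - 1) (b - 1)"
proof -
  fix P :: bool and x :: "nat \<times> nat"
  assume 1: "\<And>a. x = (a, 0) \<Longrightarrow> P"
    and 2: "\<And>b a. b \<ge> a \<Longrightarrow> b \<ge> 1 \<Longrightarrow> x = (a, b) \<Longrightarrow> P"
    and 3: "\<And>a. a \<ge> 2 \<Longrightarrow> x = (a, 1) \<Longrightarrow> P"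
    and 4: "\<And>b a. 2 \<le> b \<Longrightarrow> b \<le> a - 1 \<Longrightarrow> x = (a, b) \<Longrightarrow> P"
  obtain a b where x: "x = (a, b)" by (cases x)
  consider "b = 0" | "b \<ge> a" "b \<ge> 1" | "a \<ge> 2" "b = 1" | "2 \<le> b" "b \<le> a - 1"
    by linarith
  then show P using 1 2 3 4 x by cases auto
qed auto
termination by (relation "measure fst") auto

end

theory Submission
  imports Defs
begin

text \<open>
  Dividing \<open>Omega (Suc n) (Suc k)\<close> by \<open>(-1) ^ k * fact k\<close> turns the defining recursion into
  Pascal's rule: the coefficient \<open>- (b - 1)\<close> is exactly the ratio of the normalising factors of
  \<open>b\<close> and \<open>b - 1\<close> for \<open>b \<ge> 2\<close>, so that both terms of the recursion acquire the same factor; in the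
  first column the increment \<open>1\<close> is the summand \<open>n choose 0\<close> of the same rule. Shifting both
  arguments by one removes all natural subtractions. The closed form vanishes on and above
  the diagonal just as \<open>Omega\<close> does, so the induction on \<open>n\<close> can run over all columns
  at once; this matters because the recursion at \<open>b = a - 1\<close> refers to a diagonal value.
\<close>

lemma Omega_Suc_Suc: "Omega (Suc n) (Suc k) = (-1) ^ k * fact k * int (n choose Suc k)"
proof (induction n arbitrary: k)
  case 0
  then show ?case by simp
next
  case (Suc n)
  show ?case
  proof (cases k)
    case 0
    have "Omega (Suc (Suc n)) 1 = Omega (Suc n) 1 + 1"
      using Omega.simps(3)[of "Suc (Suc n)"] by simp
    then show ?thesis using Suc.IH[of 0] 0 by simp
  next
    case k: (Suc j)
    show ?thesis
    proof (cases "k \<le> n")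
      case True
      have "Omega (Suc (Suc n)) (Suc k) = Omega (Suc n) (Suc k) - int k * Omega (Suc n) k"
        using Omega.simps(4)[of "Suc k" "Suc (Suc n)"] True k by simp
      also have "\<dots> = (-1) ^ k * fact k * int (n choose Suc k)
                      - int k * ((-1) ^ j * fact j * int (n choose k))"
        using Suc.IH[of k] Suc.IH[of j] k by simp
      also have "\<dots> = (-1) ^ k * fact k * (int (n choose k) + int (n choose Suc k))"
        by (simp add: k algebra_simps)
      also have "\<dots> = (-1) ^ k * fact k * int (Suc n choose Suc k)"
        by simp
      finally show ?thesis .
    next
      case False
      then show ?thesis by (simp add: binomial_eq_0)
    qed
  qed
qed

theorem proposition4p4:
  fixes a b :: nat
  assumes "a > 0" and "b > 0" and "a > b"
  shows "Omega a b = (-1) ^ (b + 1) * fact (b - 1) * int ((a - 1) choose b)"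
proof -
  obtain n k where "a = Suc n" and "b = Suc k"
    using assms(1,2) by (meson gr0_implies_Suc)
  then show ?thesis by (simp add: Omega_Suc_Suc)
qed

end
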